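(* Let $0<\beta<2$ and $d\in\mathbb{N}$. Then for every $\mu>0$ there exists $u\in C_c^\infty(\mathbb{R}^d)$ with $u(x)=0$ for all $|x|\le\frac14$ such that \[0<\Gamma_2(u)(0)<\mu\big(\mathcal{L}u(0)\big)^2.\]
   Context: $c_{\beta,d}=\frac{2^\beta\Gamma(\frac{d+\beta}{2})}{\pi^{d/2}|\Gamma(-\frac{\beta}{2})|}$; $\mathcal{L}u(x)=c_{\beta,d}\int_{\mathbb{R}^d}\frac{u(x+h)-2u(x)+u(x-h)}{|h|^{d+\beta}}dh$; $\Gamma_2(u)(x)=c_{\beta,d}^2\int_{\mathbb{R}^d}\int_{\mathbb{R}^d}\frac{[u(x+h+\sigma)-u(x+h)-u(x+\sigma)+u(x)]^2}{|h|^{d+\beta}|\sigma|^{d+\beta}}dh\,d\sigma$. *)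

theory Defs
  imports "HOL-Analysis.Analysis"
begin

coinductive smooth_fun :: "('a::euclidean_space \<Rightarrow> real) \<Rightarrow> bool" where
  "continuous_on UNIV f \<Longrightarrow>
   (\<forall>b\<in>Basis. \<exists>g. (\<forall>x. ((\<lambda>t. f (x + t *\<^sub>R b)) has_real_derivative g x) (at 0)) \<and> smooth_fun g)
   \<Longrightarrow> smooth_fun f"

definition Cc_infty :: "('a::euclidean_space \<Rightarrow> real) \<Rightarrow> bool" where
  "Cc_infty u \<longleftrightarrow> smooth_fun u \<and> compact (closure {x. u x \<noteq> 0})"

definition c_const :: "real \<Rightarrow> nat \<Rightarrow> real" where
  "c_const \<beta> d = 2 powr \<beta> * Gamma ((real d + \<beta>) / 2) /
     (pi powr (real d / 2) * \<bar>Gamma (- \<beta> / 2)\<bar>)"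

definition Lop :: "real \<Rightarrow> ('a::euclidean_space \<Rightarrow> real) \<Rightarrow> 'a \<Rightarrow> real" where
  "Lop \<beta> u x = c_const \<beta> DIM('a) *
     (\<integral>h. (u (x + h) - 2 * u x + u (x - h)) / norm h powr (real DIM('a) + \<beta>) \<partial>lborel)"

definition Gamma2 :: "real \<Rightarrow> ('a::euclidean_space \<Rightarrow> real) \<Rightarrow> 'a \<Rightarrow> real" where
  "Gamma2 \<beta> u x = (c_const \<beta> DIM('a))\<^sup>2 *
     (\<integral>\<sigma>. (\<integral>h. (u (x + h + \<sigma>) - u (x + h) - u (x + \<sigma>) + u x)\<^sup>2 /
        (norm h powr (real DIM('a) + \<beta>) * norm \<sigma> powr (real DIM('a) + \<beta>)) \<partial>lborel) \<partial>lborel)"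

end

theory Submission
  imports Defs
begin

text \<open>
  At the origin \<open>\<Gamma>\<^sub>2\<close> is the squared norm of the mixed difference \<open>u(h+\<sigma>) - u(h) - u(\<sigma>) + u(0)\<close> in
  \<open>L\<^sup>2(\<nu> \<otimes> \<nu>)\<close>, where \<open>\<nu>(dh) = \<bar>h\<bar>^(-d-\<beta>) dh\<close>, and \<open>L\<close> is linear in \<open>u\<close>. Both are invariant under the
  dilations \<open>u \<mapsto> r^\<beta> u(x/r)\<close>, and if \<open>u\<close> vanishes near the origin then the mixed difference of
  its dilate vanishes for \<open>\<bar>(h,\<sigma>)\<bar> \<le> r/8\<close>. Hence \<open>u\<close> and its dilate become almost orthogonal for large \<open>r\<close>,
  and replacing \<open>u\<close> by their sum multiplies \<open>(Lu(0))\<^sup>2\<close> by 4 but \<open>\<Gamma>\<^sub>2(u)(0)\<close> by at most 3. Starting from a bump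
  supported in an annulus, iteration makes the quotient arbitrarily small.
\<close>

section \<open>Smooth building blocks: exp(-1/t) and the functions generated from it\<close>

text \<open>\<open>flat 0\<close> is the classical function exp(-1/t) extended by zero. Carrying the
  powers \<open>1 / t ^ n\<close> in the family keeps derivatives inside it with constant
  coefficients.\<close>

definition flat :: "nat \<Rightarrow> real \<Rightarrow> real" where
  "flat n t = (if t > 0 then exp (- (1 / t)) / t ^ n else 0)"

lemma flat_nonneg: "0 \<le> flat n t"
  by (simp add: flat_def)

text \<open>The term of index \<open>n + 2\<close> of the exponential series at \<open>1 / t\<close>
  already gives the bound for positive \<open>t\<close>. The quadratic order forces derivative 0 at
  the origin.\<close>

lemma flat_le_square: "flat n t \<le> fact (n + 2) * t\<^sup>2"
proof (cases "t > 0")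
  case True
  have "(\<Sum>k\<in>{n+2}. inverse (fact k) * (1 / t) ^ k) \<le> (\<Sum>k. inverse (fact k) * (1 / t) ^ k)"
    using True by (intro sum_le_suminf summable_exp) auto
  hence "(\<Sum>k\<in>{n+2}. inverse (fact k) * (1 / t) ^ k) \<le> exp (1 / t)"
    by (simp add: exp_def)
  hence "1 \<le> exp (1 / t) * (fact (n + 2) * t ^ (n + 2))"
    using True by (simp add: field_simps del: fact_Suc power_Suc)
  thus ?thesis using True
    by (simp add: flat_def exp_minus field_simps power_add power2_eq_square del: fact_Suc)
qed (simp add: flat_def)

lemma flat_has_real_derivative:
  "(flat n has_real_derivative flat (n + 2) t - n * flat (n + 1) t) (at t)"
proof -
  consider "t > 0" | "t < 0" | "t = 0" by linarith
  thus ?thesis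
  proof cases
    case 1
    have "((\<lambda>t. exp (- (1 / t)) / t ^ n) has_real_derivative flat (n + 2) t - n * flat (n + 1) t) (at t)"
      using 1
      by (auto intro!: derivative_eq_intros simp: flat_def)
         \<comment> \<open>The derivative of \<open>t ^ n\<close> contains the exponent
           \<open>n - 1\<close>, which is truncated at \<open>n = 0\<close>.\<close>
         (cases n; simp add: field_simps power2_eq_square)
    moreover have "\<forall>\<^sub>F s in nhds t. exp (- (1 / s)) / s ^ n = flat n s"
      using eventually_nhds_in_open[of "{0<..}" t] 1
      by (auto elim!: eventually_mono simp: flat_def)
    ultimately show ?thesis
      by (subst (asm) DERIV_cong_ev[OF refl _ refl]) 
  next
    case 2
    have "\<forall>\<^sub>F s in nhds t. 0 = flat n s"
      using eventually_nhds_in_open[of "{..<0}" t] 2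
      by (auto elim!: eventually_mono simp: flat_def)
    moreover have "((\<lambda>t. 0) has_real_derivative flat (n + 2) t - n * flat (n + 1) t) (at t)"
      using 2 by (simp add: flat_def)
    ultimately show ?thesis
      by (subst (asm) DERIV_cong_ev[OF refl _ refl]) 
  next
    case 3
    \<comment> \<open>At 0 the difference quotient is squeezed by
      \<open>fact (n + 2) * \<bar>h\<bar>\<close>, a consequence of
      \<open>flat_le_square\<close>.\<close>
    have "((\<lambda>h. fact (n + 2) * \<bar>h\<bar>) \<longlongrightarrow> fact (n + 2) * \<bar>0 :: real\<bar>) (at 0)"
      by (intro tendsto_intros)
    moreover have "norm (flat n h / h) \<le> fact (n + 2) * \<bar>h\<bar>" for h :: real
    proof (cases "h = 0")
      case False
      thus ?thesis using flat_le_square[of n h] flat_nonneg[of n h]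
        by (simp add: divide_le_eq power2_eq_square mult.assoc del: fact_Suc)
    qed simp
    ultimately have "((\<lambda>h. flat n h / h) \<longlongrightarrow> 0) (at 0)"
      by (intro Lim_null_comparison[of "\<lambda>h. flat n h / h"]) auto
    thus ?thesis using 3 by (simp add: DERIV_def flat_def)
  qed
qed

lemma continuous_on_flat: "continuous_on A (flat n)"
  using flat_has_real_derivative DERIV_isCont continuous_at_imp_continuous_on by blast

text \<open>The derivative of \<open>flat 0\<close> is \<open>flat 2\<close>, which is at most 2
  because \<open>exp y \<ge> y^2 / 2\<close> for \<open>y = 1 / x\<close>. The mean value inequality
  turns this into the Lipschitz constant 2.\<close>

lemma flat_0_bounds: "flat 0 t \<le> 1" "\<bar>flat 0 s - flat 0 t\<bar> \<le> 2 * \<bar>s - t\<bar>"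
proof -
  show "flat 0 t \<le> 1" by (simp add: flat_def)
  have "flat 2 x \<le> 2" for x
  proof (cases "x > 0")
    case True
    have "1 + 1 / x + (1 / x)\<^sup>2 / 2 \<le> exp (1 / x)"
      using True by (intro exp_lower_Taylor_quadratic) auto
    moreover have "0 \<le> 1 + 1 / x" using True by simp
    ultimately have "(1 / x)\<^sup>2 \<le> 2 * exp (1 / x)" by linarith
    thus ?thesis using True
      by (simp add: flat_def exp_minus field_simps)
  qed (simp add: flat_def)
  hence "\<bar>flat 2 x\<bar> \<le> 2" for x using flat_nonneg[of 2 x] by simp
  moreover have "(flat 0 has_real_derivative flat 2 x) (at x)" for x
    using flat_has_real_derivative[of 0 x] by (simp add: numeral_2_eq_2)
  ultimately show "\<bar>flat 0 s - flat 0 t\<bar> \<le> 2 * \<bar>s - t\<bar>"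
    using field_differentiable_bound[of UNIV "flat 0" "flat 2" 2 s t]
    by (auto simp: has_field_derivative_at_within)
qed

text \<open>Closed under partial derivatives because \<open>flat n' = flat (n + 2) - n * flat (n + 1)\<close>.\<close>
inductive elem_smooth :: "('a::euclidean_space \<Rightarrow> real) \<Rightarrow> bool" where
  const: "elem_smooth (\<lambda>x. c)"
| inner: "elem_smooth (\<lambda>x. x \<bullet> b)"
| add: "elem_smooth f \<Longrightarrow> elem_smooth g \<Longrightarrow> elem_smooth (\<lambda>x. f x + g x)"
| mult: "elem_smooth f \<Longrightarrow> elem_smooth g \<Longrightarrow> elem_smooth (\<lambda>x. f x * g x)"
| flat: "elem_smooth f \<Longrightarrow> elem_smooth (\<lambda>x. flat n (f x))"

lemma elem_smooth_continuous: "elem_smooth f \<Longrightarrow> continuous_on UNIV f"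
  by (induction rule: elem_smooth.induct)
     (auto intro!: continuous_intros continuous_on_compose2[OF continuous_on_flat])

lemma elem_smooth_derivative:
  assumes "elem_smooth f"
  shows "\<exists>g. elem_smooth g \<and> (\<forall>x. ((\<lambda>t. f (x + t *\<^sub>R b)) has_real_derivative g x) (at 0))"
  using assms
proof (induction rule: elem_smooth.induct)
  case (const c)
  show ?case
    by (intro exI[of _ "\<lambda>_. 0"]) (auto intro: elem_smooth.const)
next
  case (inner a)
  show ?case
    by (intro exI[of _ "\<lambda>_. b \<bullet> a"])
       (auto intro: elem_smooth.const intro!: derivative_eq_intros simp: inner_add_left)
next
  case (add f g)
  then obtain f' g' where "elem_smooth f'" "elem_smooth g'"
    "\<And>x. ((\<lambda>t. f (x + t *\<^sub>R b)) has_real_derivative f' x) (at 0)"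
    "\<And>x. ((\<lambda>t. g (x + t *\<^sub>R b)) has_real_derivative g' x) (at 0)" by blast
  thus ?case
    by (intro exI[of _ "\<lambda>x. f' x + g' x"]) (auto intro: elem_smooth.add DERIV_add)
next
  case (mult f g)
  then obtain f' g' where "elem_smooth f'" "elem_smooth g'"
    "\<And>x. ((\<lambda>t. f (x + t *\<^sub>R b)) has_real_derivative f' x) (at 0)"
    "\<And>x. ((\<lambda>t. g (x + t *\<^sub>R b)) has_real_derivative g' x) (at 0)" by blast
  thus ?case using mult.hyps
    by (intro exI[of _ "\<lambda>x. f' x * g x + g' x * f x"])
       (auto intro!: elem_smooth.add elem_smooth.mult derivative_eq_intros)
next
  case (flat f n)
  then obtain f' where f': "elem_smooth f'"
    "\<And>x. ((\<lambda>t. f (x + t *\<^sub>R b)) has_real_derivative f' x) (at 0)" by blast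
  have "((\<lambda>t. flat n (f (x + t *\<^sub>R b))) has_real_derivative
      (flat (n + 2) (f x) + (- real n) * flat (n + 1) (f x)) * f' x) (at 0)" for x
    \<comment> \<open>The base point is written \<open>x + 0 *\<^sub>R b\<close> so that it matches
      the inner function at parameter 0 in the chain rule.\<close>
    using DERIV_chain2[OF flat_has_real_derivative[of n "f (x + 0 *\<^sub>R b)"] f'(2)[of x]] by simp
  moreover have "elem_smooth (\<lambda>x. (flat (n + 2) (f x) + (- real n) * flat (n + 1) (f x)) * f' x)"
    by (intro elem_smooth.intros flat.hyps f')
  ultimately show ?case by blast
qed

text \<open>A class of continuous functions closed under partial derivatives is a valid coinduction
  invariant, and \<open>elem_smooth\<close> is such a class.\<close>

lemma elem_smooth_imp_smooth_fun: "elem_smooth f \<Longrightarrow> smooth_fun f"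
proof (coinduction arbitrary: f rule: smooth_fun.coinduct)
  case smooth_fun
  thus ?case using elem_smooth_continuous elem_smooth_derivative by blast
qed

lemma elem_smooth_sum:
  "finite A \<Longrightarrow> (\<And>i. i \<in> A \<Longrightarrow> elem_smooth (f i)) \<Longrightarrow> elem_smooth (\<lambda>x. \<Sum>i\<in>A. f i x)"
  by (induction rule: finite_induct) (auto intro: elem_smooth.intros)

text \<open>In coordinates the squared norm is a sum of squares of inner products with basis
  vectors, hence a polynomial; the norm itself is not smooth at 0.\<close>

lemma elem_smooth_norm_square: "elem_smooth (\<lambda>x. (norm x)\<^sup>2)"
  unfolding power2_norm_eq_inner euclidean_inner[of x x for x]
  by (intro elem_smooth_sum elem_smooth.intros finite_Basis)

section \<open>Closure properties of smooth functions\<close>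

lemma smooth_fun_continuous: "smooth_fun f \<Longrightarrow> continuous_on UNIV f"
  by (auto elim: smooth_fun.cases)

lemma smooth_fun_derivative:
  assumes "smooth_fun f" "b \<in> Basis"
  obtains g where "\<And>x. ((\<lambda>t. f (x + t *\<^sub>R b)) has_real_derivative g x) (at 0)" "smooth_fun g"
  using assms(1)
proof cases
  case 1
  thus ?thesis using that assms(2) by blast
qed

text \<open>The coinduction invariant consists of all sums of two smooth functions; a partial
  derivative of such a sum has the same form.\<close>

lemma smooth_fun_add:
  assumes "smooth_fun f" "smooth_fun g"
  shows "smooth_fun (\<lambda>x. f x + g x)"
  using assms
proof (coinduction arbitrary: f g rule: smooth_fun.coinduct)
  case (smooth_fun f g)
  have "\<exists>h. (\<forall>x. ((\<lambda>t. f (x + t *\<^sub>R b) + g (x + t *\<^sub>R b)) has_real_derivative h x) (at 0)) \<and>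
      (\<exists>f g. h = (\<lambda>x. f x + g x) \<and> smooth_fun f \<and> smooth_fun g)" if b: "b \<in> Basis" for b
  proof -
    obtain f' g' where "\<And>x. ((\<lambda>t. f (x + t *\<^sub>R b)) has_real_derivative f' x) (at 0)" "smooth_fun f'"
      "\<And>x. ((\<lambda>t. g (x + t *\<^sub>R b)) has_real_derivative g' x) (at 0)" "smooth_fun g'"
      using smooth_fun_derivative[OF smooth_fun(1) b] smooth_fun_derivative[OF smooth_fun(2) b]
      by metis
    thus ?thesis
      by (intro exI[of _ "\<lambda>x. f' x + g' x"] conjI exI[of _ f'] exI[of _ g']) (auto intro: DERIV_add)
  qed
  moreover have "continuous_on UNIV (\<lambda>x. f x + g x)"
    using smooth_fun by (intro continuous_on_add smooth_fun_continuous)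
  ultimately show ?case by fastforce
qed

text \<open>Each differentiation produces a factor \<open>s\<close>, so the coefficient
  \<open>c\<close> has to vary in the coinduction invariant while \<open>s\<close> stays
  fixed.\<close>

lemma smooth_fun_scale:
  assumes "smooth_fun f"
  shows "smooth_fun (\<lambda>x. c * f (s *\<^sub>R x))"
  using assms
proof (coinduction arbitrary: f c rule: smooth_fun.coinduct)
  case (smooth_fun f c)
  have cont: "continuous_on UNIV f" using smooth_fun by (rule smooth_fun_continuous)
  have "\<exists>h. (\<forall>x. ((\<lambda>t. c * f (s *\<^sub>R (x + t *\<^sub>R b))) has_real_derivative h x) (at 0)) \<and>
      (\<exists>f c. h = (\<lambda>x. c * f (s *\<^sub>R x)) \<and> smooth_fun f)" if b: "b \<in> Basis" for b
  proof -
    obtain f' where f': "\<And>x. ((\<lambda>t. f (x + t *\<^sub>R b)) has_real_derivative f' x) (at 0)" "smooth_fun f'"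
      using smooth_fun_derivative[OF smooth_fun b] by blast
    have "((\<lambda>t. c * f (s *\<^sub>R (x + t *\<^sub>R b))) has_real_derivative (c * s) * f' (s *\<^sub>R x)) (at 0)" for x
    proof -
      have "((\<lambda>t. f (s *\<^sub>R x + (s * t) *\<^sub>R b)) has_real_derivative f' (s *\<^sub>R x) * s) (at 0)"
        by (rule DERIV_chain2[where g = "\<lambda>t. s * t"])
           (use f'(1) in \<open>auto intro!: derivative_eq_intros\<close>)
      from DERIV_cmult[OF this, of c] show ?thesis
        by (simp add: scaleR_add_right mult_ac)
    qed
    thus ?thesis using f'(2)
      by (intro exI[of _ "\<lambda>x. (c * s) * f' (s *\<^sub>R x)"] conjI exI[of _ f'] exI[of _ "c * s"]) auto
  qed
  moreover have "continuous_on UNIV (\<lambda>x. c * f (s *\<^sub>R x))"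
    by (intro continuous_intros continuous_on_compose2[OF cont]) auto
  ultimately show ?case by fastforce
qed

section \<open>Lebesgue integrals: positivity, scaling and the kernel\<close>

text \<open>A vanishing integral would make \<open>U\<close> a null set, but nonempty open sets are
  not negligible.\<close>

lemma integral_pos_open:
  fixes f :: "'a::euclidean_space \<Rightarrow> real"
  assumes f: "integrable lborel f" "\<And>x. 0 \<le> f x" and U: "open U" "U \<noteq> {}" "\<And>x. x \<in> U \<Longrightarrow> 0 < f x"
  shows "0 < (\<integral>x. f x \<partial>lborel)"
proof -
  have "(\<integral>x. f x \<partial>lborel) \<noteq> 0"
  proof
    assume "(\<integral>x. f x \<partial>lborel) = 0"
    hence "AE x in lborel. f x = 0"
      using integral_nonneg_eq_0_iff_AE[OF f(1)] f(2) by simp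
    hence "AE x in lborel. x \<notin> U" by eventually_elim (use U(3) in force)
    hence "U \<in> null_sets lborel" using U(1) by (subst AE_iff_null_sets) auto
    hence "negligible U"
      by (simp add: negligible_iff_null_sets null_sets_completionI)
    thus False using U open_not_negligible by blast
  qed
  thus ?thesis using f(2) by (simp add: order_less_le)
qed

text \<open>Change of variables \<open>x / r\<close>, in the form in which the dilated integrands
  appear below. It gives integrability and the value together.\<close>

lemma has_bochner_integral_lborel_scale:
  fixes f :: "'a::euclidean_space \<Rightarrow> real"
  assumes f: "integrable lborel f" and r: "0 < r"
  shows "has_bochner_integral lborel (\<lambda>x. f (x /\<^sub>R r) / r ^ DIM('a)) (\<integral>x. f x \<partial>lborel)"
proof -
  have lb: "(lborel :: 'a measure) = density (distr lborel borel (\<lambda>x. (1 / r) *\<^sub>R x)) (\<lambda>_. ennreal ((1 / r) ^ DIM('a)))"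
    using lborel_affine[of "1 / r" "0::'a"] r by simp
  have [measurable]: "f \<in> borel_measurable borel" using f by auto
  have "integrable lborel (\<lambda>x. (1 / r) ^ DIM('a) *\<^sub>R f ((1 / r) *\<^sub>R x))"
    using f r by (subst (asm) lb) (simp add: integrable_density integrable_distr_eq)
  moreover have "(\<integral>x. f x \<partial>lborel) = (\<integral>x. (1 / r) ^ DIM('a) *\<^sub>R f ((1 / r) *\<^sub>R x) \<partial>lborel)"
    using r by (subst lb) (simp add: integral_density integral_distr)
  ultimately show ?thesis
    by (simp add: has_bochner_integral_iff power_divide inverse_eq_divide)
qed

text \<open>This is the Levy measure condition for the kernel. Dyadic shells reduce it to two
  geometric series: the one at infinity converges by \<open>0 < \<beta>\<close>, the one at the
  origin by \<open>\<beta> < 2\<close>.\<close>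

lemma integrable_min_norm_square:
  fixes \<beta> :: real
  assumes "0 < \<beta>" "\<beta> < 2"
  shows "integrable lborel (\<lambda>x::'a::euclidean_space. min 1 ((norm x)\<^sup>2) / norm x powr (real DIM('a) + \<beta>))"
    (is "integrable _ ?f")
proof (rule integrableI_bounded)
  define p where "p = real DIM('a) + \<beta>"
  define V where "V = measure lborel (ball (0::'a) 1)"
  \<comment> \<open>With \<open>p = d + \<beta>\<close>, the integrand is at most
    \<open>2^(-k p)\<close> for \<open>2^k \<le> |x| < 2^(k+1)\<close>, and at most
    \<open>2^(-2k) * 2^((k+1) p)\<close> for \<open>2^(-k-1) \<le> |x| < 2^(-k)\<close>.\<close>
  let ?a = "\<lambda>k::nat. (2::real) powr (- real k * p)"
  let ?b = "\<lambda>k::nat. (2::real) powr (p + real k * (p - 2))"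
  let ?A = "\<lambda>k::nat. ball (0::'a) (2 powr (real k + 1))"
  let ?B = "\<lambda>k::nat. ball (0::'a) (2 powr (- real k))"
  let ?g = "\<lambda>k x. ennreal (?a k) * indicator (?A k) x + ennreal (?b k) * indicator (?B k) x"
  have p: "p > 0" using assms by (simp add: p_def add_pos_nonneg)
  \<comment> \<open>Shells \<open>2^k \<le> \<bar>x\<bar> < 2^(k+1)\<close>: the balls \<open>A k\<close> cover the outer ones, the balls \<open>B k\<close> the inner ones.\<close>
  have bound: "ennreal (norm (?f x)) \<le> (\<Sum>k. ?g k x)" for x
  proof -
    have "\<exists>k. ennreal (norm (?f x)) \<le> ?g k x"
    proof (cases "x = 0")
      case False
      define l where "l = \<lfloor>log 2 (norm x)\<rfloor>"
      have l: "2 powr l \<le> norm x" "norm x < 2 powr (l + 1)"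
        using False floor_log_eq_powr_iff[of "norm x" 2 l] by (auto simp: l_def)
      have fx: "norm (?f x) = min 1 ((norm x)\<^sup>2) * norm x powr (- p)"
        by (simp add: powr_minus divide_inverse flip: p_def)
      have np: "norm x powr (- p) \<le> 2 powr (- (l * p))"
        using powr_mono2'[of "- p" "2 powr l" "norm x"] p l(1) by (simp add: powr_powr)
      show ?thesis
      proof (cases "l \<ge> 0")
        case True
        then obtain k where k: "l = int k" using nonneg_int_cases by blast
        have "norm (?f x) \<le> 1 * 2 powr (- (l * p))"
          unfolding fx by (intro mult_mono np) auto
        moreover have "x \<in> ?A k" using l k by simp
        ultimately have "ennreal (norm (?f x)) \<le> ?g k x"
          by (auto simp: k intro!: order_trans[OF ennreal_leI add_increasing2])
        thus ?thesis ..
      next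
        case F: False
        \<comment> \<open>The shift by one lets the inner shells, where \<open>l \<le> -1\<close>,
          be indexed from \<open>k = 0\<close>.\<close>
        define k where "k = nat (- l - 1)"
        have k: "real_of_int l = - real k - 1" using F by (simp add: k_def)
        have "norm (?f x) \<le> (2 powr (- real k))\<^sup>2 * 2 powr (- (l * p))"
          unfolding fx using l(2) k
          by (intro mult_mono np order_trans[OF min.cobounded2] power_mono) auto
        also have "(2 powr (- real k))\<^sup>2 = (2::real) powr (- real k * 2)"
          by (simp add: powr_powr flip: powr_realpow[of "2 powr (- real k)" 2])
        also have "\<dots> * 2 powr (- (l * p)) = ?b k"
          unfolding k by (simp add: algebra_simps flip: powr_add)
        finally have "norm (?f x) \<le> ?b k" .
        moreover have "x \<in> ?B k" using l k by simp
        ultimately have "ennreal (norm (?f x)) \<le> ?g k x"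
          by (auto intro!: order_trans[OF ennreal_leI add_increasing])
        thus ?thesis ..
      qed
    qed simp
    then obtain k where "ennreal (norm (?f x)) \<le> ?g k x" by blast
    also have "?g k x = (\<Sum>j\<in>{k}. ?g j x)" by simp
    also have "\<dots> \<le> (\<Sum>j. ?g j x)" by (intro sum_le_suminf) auto
    finally show ?thesis .
  qed
  have vol: "emeasure lborel (ball (0::'a) r) = ennreal (r ^ DIM('a) * V)" if "r > 0" for r
    using that content_ball_conv_unit_ball[of r "0::'a"] emeasure_lborel_ball_finite[of "0::'a" r]
    by (subst emeasure_eq_ennreal_measure) (auto simp: V_def less_top)
  have ball: "ball (0::'a) t \<in> sets lborel" for t by simp
  have pw: "(2 powr t) ^ n = (2::real) powr (t * real n)" for t n
    by (simp add: powr_powr flip: powr_realpow[of "2 powr t"])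
  have two_pow: "(2::real) ^ DIM('a) = 2 powr real DIM('a)"
    by (simp add: powr_realpow)
  \<comment> \<open>The ball volumes cancel the factor \<open>2^(k d)\<close> hidden in
    \<open>p\<close>, leaving the ratios \<open>2 powr (- \<beta>)\<close> and
    \<open>2 powr (\<beta> - 2)\<close>.\<close>
  have int_g: "(\<integral>\<^sup>+x. ?g k x \<partial>lborel) =
      ennreal (2 ^ DIM('a) * V * (2 powr (- \<beta>)) ^ k + 2 powr p * V * (2 powr (\<beta> - 2)) ^ k)" for k
  proof -
    have "(\<integral>\<^sup>+x. ?g k x \<partial>lborel) = (\<integral>\<^sup>+x. ennreal (?a k) * indicator (?A k) x \<partial>lborel) +
        (\<integral>\<^sup>+x. ennreal (?b k) * indicator (?B k) x \<partial>lborel)"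
      by (intro nn_integral_add borel_measurable_times_ennreal borel_measurable_const
          borel_measurable_indicator ball)
    also have "\<dots> = ennreal (?a k) * emeasure lborel (?A k) + ennreal (?b k) * emeasure lborel (?B k)"
      by (simp only: nn_integral_cmult_indicator[OF ball])
    also have "\<dots> = ennreal (?a k) * ennreal ((2 powr (real k + 1)) ^ DIM('a) * V) +
        ennreal (?b k) * ennreal ((2 powr (- real k)) ^ DIM('a) * V)"
      by (subst (1 2) vol) simp_all
    also have "\<dots> = ennreal (?a k * (2 powr (real k + 1)) ^ DIM('a) * V + ?b k * (2 powr (- real k)) ^ DIM('a) * V)"
      by (simp only: mult.assoc ennreal_mult[symmetric] ennreal_plus[symmetric] V_def
          measure_nonneg zero_le_power powr_ge_zero mult_nonneg_nonneg)
    also have "?a k * (2 powr (real k + 1)) ^ DIM('a) = 2 ^ DIM('a) * (2 powr (- \<beta>)) ^ k"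
      unfolding two_pow pw by (simp add: p_def algebra_simps flip: powr_add)
    also have "?b k * (2 powr (- real k)) ^ DIM('a) = 2 powr p * (2 powr (\<beta> - 2)) ^ k"
      unfolding pw by (simp add: p_def algebra_simps flip: powr_add)
    finally show ?thesis by (simp add: mult_ac)
  qed
  have "(\<integral>\<^sup>+x. ennreal (norm (?f x)) \<partial>lborel) \<le> (\<integral>\<^sup>+x. (\<Sum>k. ?g k x) \<partial>lborel)"
    by (intro nn_integral_mono bound)
  also have "\<dots> = (\<Sum>k. \<integral>\<^sup>+x. ?g k x \<partial>lborel)"
    by (intro nn_integral_suminf borel_measurable_add borel_measurable_times_ennreal
        borel_measurable_const borel_measurable_indicator ball)
  also have "\<dots> < \<infinity>"
  proof -
    have "(2::real) powr (- \<beta>) < 2 powr 0" "(2::real) powr (\<beta> - 2) < 2 powr 0"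
      using assms by (intro powr_less_mono; simp)+
    hence "summable (\<lambda>k. 2 ^ DIM('a) * V * (2 powr (- \<beta>)) ^ k + 2 powr p * V * (2 powr (\<beta> - 2)) ^ k)"
      by (intro summable_add summable_mult summable_geometric) auto
    moreover have "V \<ge> 0" by (simp add: V_def)
    ultimately show ?thesis unfolding int_g
      by (subst suminf_ennreal2) auto
  qed
  finally show "(\<integral>\<^sup>+x. ennreal (norm (?f x)) \<partial>lborel) < \<infinity>" .
qed measurable

text \<open>\<open>Gamma\<close> takes the value 0 exactly at the nonpositive integers, where it has
  its poles, and \<open>- \<beta> / 2\<close> lies strictly between -1 and 0.\<close>

lemma c_const_pos: "0 < \<beta> \<Longrightarrow> \<beta> < 2 \<Longrightarrow> 0 < c_const \<beta> d"
  unfolding c_const_def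
proof (intro divide_pos_pos mult_pos_pos)
  assume b: "0 < \<beta>" "\<beta> < 2"
  have "- \<beta> / 2 \<notin> \<int>\<^sub>\<le>\<^sub>0"
  proof
    assume "- \<beta> / 2 \<in> \<int>\<^sub>\<le>\<^sub>0"
    then obtain n :: int where "- \<beta> / 2 = of_int n" by (auto elim: nonpos_Ints_cases)
    hence "n < 0" "- 1 < n" using b by linarith+
    thus False by simp
  qed
  thus "0 < \<bar>Gamma (- \<beta> / 2)\<bar>" by (simp add: Gamma_eq_zero_iff)
qed (auto intro: add_nonneg_pos)

lemma integrable_lborel_product:
  fixes f :: "'a::euclidean_space \<Rightarrow> real" and g :: "'b::euclidean_space \<Rightarrow> real"
  assumes f: "integrable lborel f" and g: "integrable lborel g"
  shows "integrable lborel (\<lambda>z. f (fst z) * g (snd z))"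
proof -
  have "integrable (lborel \<Otimes>\<^sub>M lborel) (\<lambda>z. f (fst z) * g (snd z))"
    using f g by (intro lborel_pair.Fubini_integrable) (auto simp: abs_mult)
  thus ?thesis by (simp add: lborel_prod)
qed

section \<open>The integrands at the origin and their behaviour under dilation\<close>

text \<open>The pair is \<open>(\<sigma>, h)\<close>: the outer variable of \<open>Gamma2\<close>
  comes first, as Fubini expects.\<close>

definition mixed_difference :: "('a::euclidean_space \<Rightarrow> real) \<Rightarrow> 'a \<times> 'a \<Rightarrow> real" where
  "mixed_difference u z = u (snd z + fst z) - u (snd z) - u (fst z) + u 0"

definition Gamma2_integrand :: "real \<Rightarrow> ('a::euclidean_space \<Rightarrow> real) \<Rightarrow> 'a \<times> 'a \<Rightarrow> real" where
  "Gamma2_integrand \<beta> u z = (mixed_difference u z)\<^sup>2 /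
     (norm (snd z) powr (real DIM('a) + \<beta>) * norm (fst z) powr (real DIM('a) + \<beta>))"

definition Lop_integrand :: "real \<Rightarrow> ('a::euclidean_space \<Rightarrow> real) \<Rightarrow> 'a \<Rightarrow> real" where
  "Lop_integrand \<beta> u h = (u h - 2 * u 0 + u (- h)) / norm h powr (real DIM('a) + \<beta>)"

text \<open>The factor \<open>r powr \<beta>\<close> compensates the homogeneity of the kernel, so
  that both operators at 0 are invariant.\<close>

definition dilate :: "real \<Rightarrow> real \<Rightarrow> ('a::euclidean_space \<Rightarrow> real) \<Rightarrow> 'a \<Rightarrow> real" where
  "dilate \<beta> r u x = r powr \<beta> * u (x /\<^sub>R r)"

text \<open>Integrability is carried along because the Bochner integral of a non-integrable function
  is 0 by convention; additivity, comparison and Fubini all rely on it.\<close>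

definition admissible :: "real \<Rightarrow> ('a::euclidean_space \<Rightarrow> real) \<Rightarrow> bool" where
  "admissible \<beta> u \<longleftrightarrow> Cc_infty u \<and> (\<forall>x. norm x \<le> 1/4 \<longrightarrow> u x = 0) \<and>
     integrable lborel (Lop_integrand \<beta> u) \<and> integrable lborel (Gamma2_integrand \<beta> u)"

lemma Lop_at_0: "Lop \<beta> u (0::'a::euclidean_space) = c_const \<beta> DIM('a) * (\<integral>h. Lop_integrand \<beta> u h \<partial>lborel)"
  by (simp add: Lop_def Lop_integrand_def)

text \<open>By Fubini the iterated integral becomes a single one over pairs, to which tail and
  domination arguments apply.\<close>

lemma Gamma2_at_0:
  fixes u :: "'a::euclidean_space \<Rightarrow> real"
  assumes "integrable lborel (Gamma2_integrand \<beta> u)"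
  shows "Gamma2 \<beta> u 0 = (c_const \<beta> DIM('a))\<^sup>2 * (\<integral>z. Gamma2_integrand \<beta> u z \<partial>lborel)"
proof -
  have "(\<integral>\<sigma>. (\<integral>h. Gamma2_integrand \<beta> u (\<sigma>, h) \<partial>lborel) \<partial>lborel) = (\<integral>z. Gamma2_integrand \<beta> u z \<partial>lborel)"
    using assms lborel_pair.integral_fst'[of "Gamma2_integrand \<beta> u"] by (simp add: lborel_prod)
  thus ?thesis
    unfolding Gamma2_def by (simp add: Gamma2_integrand_def[of _ _ "(_, _)"] mixed_difference_def)
qed

lemma Gamma2_integrand_nonneg: "0 \<le> Gamma2_integrand \<beta> u z"
  by (simp add: Gamma2_integrand_def)

text \<open>All four evaluation points lie in the ball of radius 1/4.\<close>

lemma mixed_difference_eq_0: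
  assumes "\<And>x. norm x \<le> 1/4 \<Longrightarrow> u x = 0" "norm (fst z) \<le> 1/8" "norm (snd z) \<le> 1/8"
  shows "mixed_difference u z = 0"
proof -
  have "norm (snd z + fst z) \<le> 1/4"
    using norm_triangle_ineq[of "snd z" "fst z"] assms(2,3) by linarith
  thus ?thesis using assms by (simp add: mixed_difference_def)
qed

lemma continuous_on_mixed_difference:
  assumes "continuous_on UNIV u"
  shows "continuous_on UNIV (mixed_difference u)"
  unfolding mixed_difference_def
  by (intro continuous_intros continuous_on_compose2[OF assms]) auto

lemma borel_measurable_Gamma2_integrand:
  assumes "continuous_on UNIV u"
  shows "Gamma2_integrand \<beta> u \<in> borel_measurable borel"
proof -
  have [measurable]: "mixed_difference u \<in> borel_measurable borel"
    using assms by (intro borel_measurable_continuous_onI continuous_on_mixed_difference)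
  have [measurable]: "(\<lambda>z::'a\<times>'a. norm (fst z)) \<in> borel_measurable borel"
    "(\<lambda>z::'a\<times>'a. norm (snd z)) \<in> borel_measurable borel"
    by (intro borel_measurable_continuous_onI continuous_intros)+
  show ?thesis unfolding Gamma2_integrand_def by measurable
qed

lemma borel_measurable_Lop_integrand:
  assumes "continuous_on UNIV u"
  shows "Lop_integrand \<beta> u \<in> borel_measurable borel"
proof -
  have [measurable]: "u \<in> borel_measurable borel"
    using assms by (rule borel_measurable_continuous_onI)
  show ?thesis unfolding Lop_integrand_def by measurable
qed

lemma mixed_difference_dilate:
  "mixed_difference (dilate \<beta> r u) z = r powr \<beta> * mixed_difference u (z /\<^sub>R r)"
  by (simp add: mixed_difference_def dilate_def algebra_simps)

text \<open>The square contributes \<open>r^(2 \<beta>)\<close> and the two kernels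
  \<open>r^(-2 d - 2 \<beta>)\<close>; what remains is the Jacobian of the dilation on
  pairs.\<close>

lemma Gamma2_integrand_dilate:
  fixes u :: "'a::euclidean_space \<Rightarrow> real"
  assumes r: "0 < r"
  shows "Gamma2_integrand \<beta> (dilate \<beta> r u) z = Gamma2_integrand \<beta> u (z /\<^sub>R r) / r ^ DIM('a \<times> 'a)"
proof -
  let ?p = "real DIM('a) + \<beta>"
  have k: "norm (x /\<^sub>R r) powr ?p = norm x powr ?p / (r ^ DIM('a) * r powr \<beta>)" for x :: 'a
    using r by (simp add: powr_mult powr_divide powr_add powr_realpow inverse_eq_divide)
  have "r powr \<beta> > 0" using r by simp
  thus ?thesis using r
    by (simp add: Gamma2_integrand_def mixed_difference_dilate k power_mult_distrib power_add
        power2_eq_square del: norm_scaleR)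
qed

lemma Lop_integrand_dilate:
  fixes u :: "'a::euclidean_space \<Rightarrow> real"
  assumes r: "0 < r"
  shows "Lop_integrand \<beta> (dilate \<beta> r u) h = Lop_integrand \<beta> u (h /\<^sub>R r) / r ^ DIM('a)"
proof -
  let ?p = "real DIM('a) + \<beta>"
  have k: "norm (x /\<^sub>R r) powr ?p = norm x powr ?p / (r ^ DIM('a) * r powr \<beta>)" for x :: 'a
    using r by (simp add: powr_mult powr_divide powr_add powr_realpow inverse_eq_divide)
  have "r powr \<beta> > 0" using r by simp
  thus ?thesis using r
    by (simp add: Lop_integrand_def dilate_def k del: norm_scaleR) (simp add: field_simps)
qed

lemma Cc_infty_add:
  assumes "Cc_infty u" "Cc_infty v"
  shows "Cc_infty (\<lambda>x. u x + v x)"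
proof -
  have "bounded ({x. u x \<noteq> 0} \<union> {x. v x \<noteq> 0})"
    using assms by (simp add: Cc_infty_def compact_closure)
  hence "bounded {x. u x + v x \<noteq> 0}" by (rule bounded_subset) auto
  thus ?thesis using assms by (simp add: Cc_infty_def smooth_fun_add compact_closure)
qed

lemma Cc_infty_dilate:
  assumes "Cc_infty u" "0 < r"
  shows "Cc_infty (dilate \<beta> r u)"
proof -
  have "bounded ((\<lambda>x. r *\<^sub>R x) ` {x. u x \<noteq> 0})"
    using assms by (intro bounded_scaling) (simp add: Cc_infty_def compact_closure)
  moreover have "{x. dilate \<beta> r u x \<noteq> 0} \<subseteq> (\<lambda>x. r *\<^sub>R x) ` {x. u x \<noteq> 0}"
  proof
    fix x assume "x \<in> {x. dilate \<beta> r u x \<noteq> 0}"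
    thus "x \<in> (\<lambda>x. r *\<^sub>R x) ` {x. u x \<noteq> 0}"
      using assms(2) by (intro image_eqI[of _ _ "x /\<^sub>R r"]) (auto simp: dilate_def)
  qed
  ultimately have "bounded {x. dilate \<beta> r u x \<noteq> 0}" by (rule bounded_subset)
  moreover have "smooth_fun (dilate \<beta> r u)"
    using smooth_fun_scale[of u "r powr \<beta>" "inverse r"] assms(1)
    by (simp add: dilate_def[abs_def] Cc_infty_def)
  ultimately show ?thesis by (simp add: Cc_infty_def compact_closure)
qed

section \<open>The doubling step and its iteration\<close>

text \<open>Dominated convergence along the radii \<open>R + n\<close>. A zero integral is treated
  apart, since then the bound on the right is not positive and any radius works.\<close>

lemma tail_integral_small:
  fixes f :: "'a::euclidean_space \<Rightarrow> real"
  assumes f: "integrable lborel f" "\<And>x. 0 \<le> f x" and "0 < e"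
  obtains r where "R \<le> r" "(\<integral>x. f x * indicator {x. r < norm x} x \<partial>lborel) \<le> e * (\<integral>x. f x \<partial>lborel)"
proof (cases "(\<integral>x. f x \<partial>lborel) = 0")
  case True
  have "(\<integral>x. f x * indicator {x. R < norm x} x \<partial>lborel) \<le> (\<integral>x. f x \<partial>lborel)"
    using f by (intro integral_mono integrable_real_mult_indicator) (auto simp: indicator_def)
  thus ?thesis using True that[of R] by simp
next
  case False
  have [measurable]: "f \<in> borel_measurable borel" using f by auto
  have pos: "0 < e * (\<integral>x. f x \<partial>lborel)"
    using False f(2) \<open>0 < e\<close> by (simp add: order_less_le)
  have "(\<lambda>n. \<integral>x. f x * indicator {x. R + real n < norm x} x \<partial>lborel) \<longlonglongrightarrow> (\<integral>x. 0 \<partial>(lborel :: 'a measure))"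
  proof (rule integral_dominated_convergence[where w = f])
    show "AE x in lborel. (\<lambda>n. f x * indicator {x. R + real n < norm x} x) \<longlonglongrightarrow> 0"
    proof (rule AE_I2)
      fix x :: 'a
      obtain N :: nat where N: "norm x - R < N" using reals_Archimedean2 by blast
      have "\<forall>\<^sub>F n in sequentially. f x * indicator {x. R + real n < norm x} x = 0"
        using eventually_ge_at_top[of N]
      proof eventually_elim
        case (elim n)
        hence "real N \<le> real n" by simp
        thus ?case using N by (simp add: indicator_def)
      qed
      thus "(\<lambda>n. f x * indicator {x. R + real n < norm x} x) \<longlonglongrightarrow> 0"
        by (rule tendsto_eventually)
    qed
  qed (use f in \<open>auto simp: indicator_def\<close>)
  hence "\<forall>\<^sub>F n in sequentially. (\<integral>x. f x * indicator {x. R + real n < norm x} x \<partial>lborel) < e * (\<integral>x. f x \<partial>lborel)"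
    using pos by (intro order_tendstoD) auto
  then obtain n where "(\<integral>x. f x * indicator {x. R + real n < norm x} x \<partial>lborel) < e * (\<integral>x. f x \<partial>lborel)"
    using eventually_sequentially by auto
  thus ?thesis using that[of "R + real n"] by simp
qed

text \<open>Exact orthogonality of \<open>u\<close> and its dilate would give the factor 2. The
  factor 3 leaves room for the overlap and is still below 4, the growth of the squared
  \<open>Lop\<close>.\<close>

lemma admissible_doubling:
  fixes u :: "'a::euclidean_space \<Rightarrow> real"
  assumes u: "admissible \<beta> u"
  obtains v :: "'a \<Rightarrow> real" where "admissible \<beta> v" "Lop \<beta> v 0 = 2 * Lop \<beta> u 0" "Gamma2 \<beta> v 0 \<le> 3 * Gamma2 \<beta> u 0"
proof -
  let ?G = "Gamma2_integrand \<beta> u"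
  have L: "integrable lborel (Lop_integrand \<beta> u)" and G: "integrable lborel ?G" and cc: "Cc_infty u"
    and u0: "\<And>x. norm x \<le> 1/4 \<Longrightarrow> u x = 0"
    using u by (auto simp: admissible_def)
  \<comment> \<open>The lower bound 1/8 yields \<open>r \<ge> 1\<close>, so the dilate also vanishes
    on the ball of radius 1/4.\<close>
  obtain r' where r': "1/8 \<le> r'"
    "(\<integral>z. ?G z * indicator {z. r' < norm z} z \<partial>lborel) \<le> 1/4 * (\<integral>z. ?G z \<partial>lborel)"
    using tail_integral_small[OF G Gamma2_integrand_nonneg, of "1/4" "1/8"] by auto
  define r where "r = 8 * r'"
  have r: "1 \<le> r"
    "(\<integral>z. ?G z * indicator {z. r / 8 < norm z} z \<partial>lborel) \<le> 1/4 * (\<integral>z. ?G z \<partial>lborel)"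
    using r' by (auto simp: r_def)
  define T where "T = {z::'a\<times>'a. r / 8 < norm z}"
  define w where "w = dilate \<beta> r u"
  define v where "v = (\<lambda>x. u x + w x)"
  have T: "T \<in> sets lborel"
    unfolding T_def by (simp add: open_Collect_less continuous_intros)
  have Gw: "has_bochner_integral lborel (Gamma2_integrand \<beta> w) (\<integral>z. ?G z \<partial>lborel)"
    using has_bochner_integral_lborel_scale[OF G, of r] r(1)
    by (simp add: w_def Gamma2_integrand_dilate cong: has_bochner_integral_cong)
  have Lw: "has_bochner_integral lborel (Lop_integrand \<beta> w) (\<integral>h. Lop_integrand \<beta> u h \<partial>lborel)"
    using has_bochner_integral_lborel_scale[OF L, of r] r(1)
    by (simp add: w_def Lop_integrand_dilate cong: has_bochner_integral_cong)
  have ccv: "Cc_infty v"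
    unfolding v_def w_def using cc r(1) by (intro Cc_infty_add Cc_infty_dilate) auto
  hence contv: "continuous_on UNIV v" by (simp add: Cc_infty_def smooth_fun_continuous)
  have v0: "v x = 0" if "norm x \<le> 1/4" for x
  proof -
    have "norm (x /\<^sub>R r) \<le> 1/4" using that r(1) by (simp add: field_simps)
    thus ?thesis using u0 that by (simp add: v_def w_def dilate_def)
  qed
  have "Lop_integrand \<beta> v = (\<lambda>h. Lop_integrand \<beta> u h + Lop_integrand \<beta> w h)"
    by (rule ext) (simp add: Lop_integrand_def v_def add_divide_distrib diff_divide_distrib algebra_simps)
  hence Lv: "has_bochner_integral lborel (Lop_integrand \<beta> v) (2 * (\<integral>h. Lop_integrand \<beta> u h \<partial>lborel))"
    using has_bochner_integral_add[OF has_bochner_integral_integrable[OF L] Lw]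
    by simp
  \<comment> \<open>Since the tail over \<open>T\<close> carries at most a quarter of the integral,
    the total is \<open>1 + 3/2 + 2 * 1/4 = 3\<close> times the integral of
    \<open>?G\<close>.\<close>
  let ?M = "\<lambda>z. ?G z + 3/2 * Gamma2_integrand \<beta> w z + 2 * (?G z * indicator T z)"
  have bound: "Gamma2_integrand \<beta> v z \<le> ?M z" for z
  proof -
    let ?a = "mixed_difference u z" and ?b = "mixed_difference w z"
    have "(mixed_difference v z)\<^sup>2 \<le> ?a\<^sup>2 + 3/2 * ?b\<^sup>2 + 2 * (?a\<^sup>2 * indicator T z)"
    proof -
      have v: "mixed_difference v z = ?a + ?b" by (simp add: mixed_difference_def v_def)
      show ?thesis
      proof (cases "z \<in> T")
        case True
        \<comment> \<open>Half of this square is the gap in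
          \<open>(a + b)^2 \<le> 3 a^2 + 3/2 b^2\<close>.\<close>
        have "0 \<le> (2 * ?a - ?b)\<^sup>2" by simp
        thus ?thesis using True by (simp add: v power2_eq_square algebra_simps)
      next
        case False
        \<comment> \<open>Outside \<open>T\<close> the rescaled point falls where the mixed
          difference of \<open>u\<close> vanishes, so only the term of \<open>u\<close>
          survives.\<close>
        hence "norm (z /\<^sub>R r) \<le> 1/8" using r(1) by (simp add: T_def field_simps)
        hence "norm (fst (z /\<^sub>R r)) \<le> 1/8" "norm (snd (z /\<^sub>R r)) \<le> 1/8"
          using norm_fst_le[of "fst (z /\<^sub>R r)" "snd (z /\<^sub>R r)"]
            norm_snd_le[of "snd (z /\<^sub>R r)" "fst (z /\<^sub>R r)"] unfolding prod.collapse by linarith+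
        hence "mixed_difference u (z /\<^sub>R r) = 0"
          by (intro mixed_difference_eq_0[of u]) (use u0 in auto)
        hence "?b = 0" by (simp add: w_def mixed_difference_dilate)
        thus ?thesis using False by (simp add: v)
      qed
    qed
    from divide_right_mono[OF this, of "norm (snd z) powr (real DIM('a) + \<beta>) * norm (fst z) powr (real DIM('a) + \<beta>)"]
    show ?thesis by (simp add: Gamma2_integrand_def add_divide_distrib)
  qed
  have M: "has_bochner_integral lborel ?M ((\<integral>z. ?G z \<partial>lborel) + 3/2 * (\<integral>z. ?G z \<partial>lborel)
      + 2 * (\<integral>z. ?G z * indicator T z \<partial>lborel))"
    using G Gw T
    by (intro has_bochner_integral_add has_bochner_integral_mult_right
        has_bochner_integral_integrable integrable_real_mult_indicator) auto
  have Gv: "integrable lborel (Gamma2_integrand \<beta> v)"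
  proof (rule Bochner_Integration.integrable_bound)
    show "integrable lborel ?M" using M by (rule integrable.intros)
    show "AE z in lborel. norm (Gamma2_integrand \<beta> v z) \<le> norm (?M z)"
    proof (rule AE_I2)
      fix z :: "'a \<times> 'a"
      show "norm (Gamma2_integrand \<beta> v z) \<le> norm (?M z)"
        using bound[of z] Gamma2_integrand_nonneg[of \<beta> v z] by simp
    qed
  qed (simp add: borel_measurable_Gamma2_integrand[OF contv])
  have "(\<integral>z. Gamma2_integrand \<beta> v z \<partial>lborel) \<le> (\<integral>z. ?M z \<partial>lborel)"
    using Gv M by (intro integral_mono bound) (auto simp: has_bochner_integral_iff)
  also have "\<dots> = (\<integral>z. ?G z \<partial>lborel) + 3/2 * (\<integral>z. ?G z \<partial>lborel) + 2 * (\<integral>z. ?G z * indicator T z \<partial>lborel)"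
    using M by (rule has_bochner_integral_integral_eq)
  also have "\<dots> \<le> 3 * (\<integral>z. ?G z \<partial>lborel)"
    using r(2) by (simp add: T_def)
  finally have le: "(\<integral>z. Gamma2_integrand \<beta> v z \<partial>lborel) \<le> 3 * (\<integral>z. ?G z \<partial>lborel)" .
  show ?thesis
  proof (rule that)
    show "admissible \<beta> v"
      using ccv v0 Lv Gv by (auto simp: admissible_def has_bochner_integral_iff)
    show "Lop \<beta> v 0 = 2 * Lop \<beta> u 0"
      using Lv by (simp add: Lop_at_0 has_bochner_integral_iff)
    show "Gamma2 \<beta> v 0 \<le> 3 * Gamma2 \<beta> u 0"
      using mult_left_mono[OF le, of "(c_const \<beta> DIM('a))\<^sup>2"]
      by (simp add: Gamma2_at_0 G Gv mult_ac)
  qed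
qed

lemma admissible_iterate:
  fixes u :: "'a::euclidean_space \<Rightarrow> real"
  assumes "admissible \<beta> u"
  shows "\<exists>v :: 'a \<Rightarrow> real. admissible \<beta> v \<and> Lop \<beta> v 0 = 2 ^ n * Lop \<beta> u 0 \<and> Gamma2 \<beta> v 0 \<le> 3 ^ n * Gamma2 \<beta> u 0"
proof (induction n)
  case 0
  show ?case using assms by (intro exI[of _ u]) auto
next
  case (Suc n)
  then obtain v :: "'a \<Rightarrow> real" where v: "admissible \<beta> v" "Lop \<beta> v 0 = 2 ^ n * Lop \<beta> u 0"
    "Gamma2 \<beta> v 0 \<le> 3 ^ n * Gamma2 \<beta> u 0" by blast
  obtain v' :: "'a \<Rightarrow> real" where "admissible \<beta> v'" "Lop \<beta> v' 0 = 2 * Lop \<beta> v 0" "Gamma2 \<beta> v' 0 \<le> 3 * Gamma2 \<beta> v 0"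
    using admissible_doubling[OF v(1)] .
  thus ?case using v by (intro exI[of _ v']) auto
qed

section \<open>Strict positivity of \<open>Gamma2\<close>\<close>

text \<open>By continuity one pair with nonzero mixed difference suffices; the pair
  \<open>(h, h)\<close> works for a maximum point \<open>h\<close> of \<open>\<bar>u\<bar>\<close>.
  The hypothesis on \<open>Lop\<close> ensures that \<open>u\<close> is not identically 0.\<close>

lemma Gamma2_pos:
  fixes u :: "'a::euclidean_space \<Rightarrow> real"
  assumes \<beta>: "0 < \<beta>" "\<beta> < 2" and u: "admissible \<beta> u" "Lop \<beta> u 0 \<noteq> 0"
  shows "0 < Gamma2 \<beta> u 0"
proof -
  have G: "integrable lborel (Gamma2_integrand \<beta> u)" and cc: "Cc_infty u" and u0: "u 0 = 0"
    using u by (auto simp: admissible_def)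
  have cont: "continuous_on UNIV u" using cc by (simp add: Cc_infty_def smooth_fun_continuous)
  let ?K = "closure {x. u x \<noteq> 0}"
  obtain x where x: "u x \<noteq> 0"
  proof (rule ccontr)
    assume "\<not> thesis"
    hence "u = (\<lambda>_. 0)" using that by blast
    thus False using u(2) by (simp add: Lop_def)
  qed
  hence "x \<in> ?K" by (intro subsetD[OF closure_subset]) simp
  have "\<exists>h\<in>?K. \<forall>y\<in>?K. \<bar>u y\<bar> \<le> \<bar>u h\<bar>"
  proof (rule continuous_attains_sup)
    show "continuous_on ?K (\<lambda>y. \<bar>u y\<bar>)"
      using continuous_on_subset[OF cont] by (intro continuous_on_rabs) auto
    show "compact ?K" using cc by (simp add: Cc_infty_def)
    show "?K \<noteq> {}" using \<open>x \<in> ?K\<close> by (metis empty_iff)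
  qed
  then obtain h where h: "\<forall>y\<in>?K. \<bar>u y\<bar> \<le> \<bar>u h\<bar>" ..
  have max: "\<bar>u y\<bar> \<le> \<bar>u h\<bar>" for y
  proof (cases "u y = 0")
    case False
    hence "y \<in> ?K" by (intro subsetD[OF closure_subset]) simp
    thus ?thesis using h by (rule bspec[rotated])
  qed simp
  have uh: "u h \<noteq> 0" using max[of x] x by auto
  \<comment> \<open>Pairs with a zero component are removed because there the kernel is a division
    by zero and the integrand takes the value 0.\<close>
  let ?U = "{z. mixed_difference u z \<noteq> 0} \<inter> {z. fst z \<noteq> 0} \<inter> {z. snd z \<noteq> 0}"
  \<comment> \<open>As \<open>\<bar>u h\<bar>\<close> is maximal, \<open>u (2h)\<close> cannot equal \<open>2 u(h)\<close>.\<close>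
  have "mixed_difference u (h, h) \<noteq> 0"
    using max[of "h + h"] uh by (auto simp: mixed_difference_def u0)
  hence "(h, h) \<in> ?U" using uh u0 by auto
  moreover have "open ?U"
    using continuous_on_mixed_difference[OF cont]
    by (intro open_Int open_Collect_neq continuous_intros)
  ultimately have "0 < (\<integral>z. Gamma2_integrand \<beta> u z \<partial>lborel)"
    by (intro integral_pos_open[OF G Gamma2_integrand_nonneg])
       (auto simp: Gamma2_integrand_def)
  thus ?thesis using c_const_pos[OF \<beta>] by (simp add: Gamma2_at_0[OF G] order_less_imp_not_eq2)
qed

section \<open>A sufficient condition for admissibility\<close>

text \<open>Boundedness and the Lipschitz condition bound the squared mixed difference by a multiple
  of \<open>m\<close> in either variable alone. The product of both is reached because the mixed
  difference vanishes near the origin and \<open>m \<ge> 1/64\<close> elsewhere in one of the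
  variables.\<close>

lemma admissibleI_bounded_lipschitz:
  fixes u :: "'a::euclidean_space \<Rightarrow> real"
  assumes \<beta>: "0 < \<beta>" "\<beta> < 2" and cc: "Cc_infty u" and u0: "\<And>x. norm x \<le> 1/4 \<Longrightarrow> u x = 0"
    and B: "\<And>x. \<bar>u x\<bar> \<le> B" and C: "\<And>x y. \<bar>u x - u y\<bar> \<le> C * norm (x - y)"
  shows "admissible \<beta> u"
proof -
  define p where "p = real DIM('a) + \<beta>"
  define m where "m = (\<lambda>x::'a. min 1 ((norm x)\<^sup>2))"
  have int: "integrable lborel (\<lambda>x::'a. m x / norm x powr p)"
    unfolding m_def p_def using \<beta> by (rule integrable_min_norm_square)
  have cont: "continuous_on UNIV u" using cc by (simp add: Cc_infty_def smooth_fun_continuous)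
  have m: "0 \<le> m x" "m x \<le> 1" for x by (auto simp: m_def)
  have m8: "1 \<le> 64 * m x" if "\<not> norm x \<le> 1/8" for x
  proof -
    have "(1/8)\<^sup>2 \<le> (norm x)\<^sup>2" using that by (intro power_mono) auto
    thus ?thesis by (simp add: m_def min_def power2_eq_square)
  qed
  have B0: "0 \<le> B" using B[of 0] by linarith
  obtain a :: 'a where a: "norm a = 1" using vector_choose_size[of 1] by auto
  have C0: "0 \<le> C" using C[of a 0] a by auto
  define A where "A = 2 * C + 4 * B"
  have sq: "d\<^sup>2 \<le> A\<^sup>2 * m x" if "\<bar>d\<bar> \<le> 2 * C * norm x" "\<bar>d\<bar> \<le> 4 * B" for d and x :: 'a
  proof -
    have "\<bar>d\<bar> \<le> A * 1" "\<bar>d\<bar> \<le> A * norm x"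
      using that B0 C0 by (auto simp: A_def algebra_simps intro: add_increasing add_increasing2)
    hence "\<bar>d\<bar>\<^sup>2 \<le> (A * 1)\<^sup>2" "\<bar>d\<bar>\<^sup>2 \<le> (A * norm x)\<^sup>2"
      by (intro power_mono; simp)+
    thus ?thesis by (auto simp: m_def min_def power_mult_distrib)
  qed
  have bound: "(mixed_difference u z)\<^sup>2 \<le> 64 * A\<^sup>2 * (m (fst z) * m (snd z))" for z
  proof -
    let ?d = "mixed_difference u z"
    have d4: "\<bar>?d\<bar> \<le> 4 * B"
      using B[of "snd z + fst z"] B[of "snd z"] B[of "fst z"] B[of 0]
      unfolding mixed_difference_def by linarith
    \<comment> \<open>The four terms are paired into two increments by \<open>fst z\<close>; the
      other pairing below gives two increments by \<open>snd z\<close>.\<close>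
    have "\<bar>?d\<bar> \<le> 2 * C * norm (fst z)"
      using C[of "snd z + fst z" "snd z"] C[of "fst z" 0]
      unfolding mixed_difference_def by simp
    hence d1: "?d\<^sup>2 \<le> A\<^sup>2 * m (fst z)" using d4 by (rule sq)
    have "\<bar>?d\<bar> \<le> 2 * C * norm (snd z)"
      using C[of "snd z + fst z" "fst z"] C[of "snd z" 0]
      unfolding mixed_difference_def by simp
    hence d2: "?d\<^sup>2 \<le> A\<^sup>2 * m (snd z)" using d4 by (rule sq)
    consider "norm (fst z) \<le> 1/8" "norm (snd z) \<le> 1/8" | "\<not> norm (fst z) \<le> 1/8" | "\<not> norm (snd z) \<le> 1/8"
      by blast
    thus ?thesis
    proof cases
      case 1
      hence "?d = 0" by (intro mixed_difference_eq_0[of u]) (use u0 in auto)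
      thus ?thesis using m by simp
    next
      case 2
      \<comment> \<open>The small-increment bound is used in the other variable, and the large one
        pays the factor 64.\<close>
      have "A\<^sup>2 * m (snd z) * 1 \<le> A\<^sup>2 * m (snd z) * (64 * m (fst z))"
        using m8[OF 2] m by (intro mult_left_mono) auto
      thus ?thesis using d2 by (simp add: mult_ac)
    next
      case 3
      have "A\<^sup>2 * m (fst z) * 1 \<le> A\<^sup>2 * m (fst z) * (64 * m (snd z))"
        using m8[OF 3] m by (intro mult_left_mono) auto
      thus ?thesis using d1 by (simp add: mult_ac)
    qed
  qed
  have "integrable lborel (Gamma2_integrand \<beta> u)"
  proof (rule Bochner_Integration.integrable_bound)
    show "integrable lborel (\<lambda>z::'a\<times>'a. 64 * A\<^sup>2 * ((m (fst z) / norm (fst z) powr p) * (m (snd z) / norm (snd z) powr p)))"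
      by (intro integrable_mult_right integrable_lborel_product int)
    show "AE z in lborel. norm (Gamma2_integrand \<beta> u z) \<le>
        norm (64 * A\<^sup>2 * ((m (fst z) / norm (fst z) powr p) * (m (snd z) / norm (snd z) powr p)))"
    proof (rule AE_I2)
      fix z :: "'a \<times> 'a"
      have "Gamma2_integrand \<beta> u z \<le> 64 * A\<^sup>2 * (m (fst z) * m (snd z)) / (norm (snd z) powr p * norm (fst z) powr p)"
        unfolding Gamma2_integrand_def p_def[symmetric] by (intro divide_right_mono bound) auto
      thus "norm (Gamma2_integrand \<beta> u z) \<le>
        norm (64 * A\<^sup>2 * ((m (fst z) / norm (fst z) powr p) * (m (snd z) / norm (snd z) powr p)))"
        using m Gamma2_integrand_nonneg[of \<beta> u z] by (simp add: abs_mult mult_ac)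
    qed
  qed (simp add: borel_measurable_Gamma2_integrand[OF cont])
  moreover have "integrable lborel (Lop_integrand \<beta> u)"
  proof (rule Bochner_Integration.integrable_bound)
    \<comment> \<open>The numerator is 0 for \<open>norm h \<le> 1/8\<close> and at most
      \<open>2 * B\<close> otherwise, where \<open>m h \<ge> 1/64\<close>.\<close>
    show "integrable lborel (\<lambda>h::'a. 128 * B * (m h / norm h powr p))"
      by (intro integrable_mult_right int)
    show "AE h in lborel. norm (Lop_integrand \<beta> u h) \<le> norm (128 * B * (m h / norm h powr p))"
    proof (rule AE_I2)
      fix h :: 'a
      have "\<bar>u h - 2 * u 0 + u (- h)\<bar> \<le> 128 * B * m h"
      proof (cases "norm h \<le> 1/8")
        case True
        thus ?thesis using u0 m B0 by simp
      next
        case False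
        have "2 * B * 1 \<le> 2 * B * (64 * m h)"
          using m8[OF False] B0 by (intro mult_left_mono) auto
        thus ?thesis using B[of h] B[of "- h"] u0[of 0] by simp
      qed
      hence "\<bar>u h - 2 * u 0 + u (- h)\<bar> / norm h powr p \<le> 128 * B * m h / norm h powr p"
        by (intro divide_right_mono) auto
      thus "norm (Lop_integrand \<beta> u h) \<le> norm (128 * B * (m h / norm h powr p))"
        using m B0 by (simp add: Lop_integrand_def p_def abs_mult)
    qed
  qed (simp add: borel_measurable_Lop_integrand[OF cont])
  ultimately show ?thesis using cc u0 by (simp add: admissible_def)
qed

section \<open>The starting bump on an annulus\<close>

text \<open>Positive exactly for \<open>1 < norm x < 2\<close>; the squared norm makes it a
  composition within \<open>elem_smooth\<close>.\<close>

definition annulus_bump :: "'a::euclidean_space \<Rightarrow> real" where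
  "annulus_bump x = flat 0 ((norm x)\<^sup>2 - 1) * flat 0 (4 - (norm x)\<^sup>2)"

lemma annulus_bump_eq_0:
  assumes "norm x \<le> 1 \<or> 2 \<le> norm x"
  shows "annulus_bump x = 0"
proof -
  have "(norm x)\<^sup>2 \<le> 1\<^sup>2 \<or> 2\<^sup>2 \<le> (norm x)\<^sup>2"
    using assms
  proof
    assume "norm x \<le> 1"
    hence "(norm x)\<^sup>2 \<le> 1\<^sup>2" by (rule power_mono) simp
    thus ?thesis ..
  next
    assume "2 \<le> norm x"
    hence "2\<^sup>2 \<le> (norm x)\<^sup>2" by (rule power_mono) simp
    thus ?thesis ..
  qed
  thus ?thesis by (elim disjE) (simp_all add: annulus_bump_def flat_def)
qed

lemma annulus_bump_nonneg: "0 \<le> annulus_bump x"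
  by (simp add: annulus_bump_def flat_nonneg)

lemma annulus_bump_pos:
  assumes "1 < norm x" "norm x < 2"
  shows "0 < annulus_bump x"
proof -
  have "1\<^sup>2 < (norm x)\<^sup>2" "(norm x)\<^sup>2 < 2\<^sup>2"
    using assms by (intro power_strict_mono; simp)+
  thus ?thesis by (simp add: annulus_bump_def flat_def)
qed

lemma Cc_infty_annulus_bump: "Cc_infty annulus_bump"
proof -
  have "elem_smooth (\<lambda>x::'a. flat 0 ((norm x)\<^sup>2 + (- 1)) * flat 0 (4 + (- 1) * (norm x)\<^sup>2))"
    by (intro elem_smooth.intros elem_smooth_norm_square)
  hence "smooth_fun (annulus_bump :: 'a \<Rightarrow> real)"
    unfolding annulus_bump_def[abs_def] by (intro elem_smooth_imp_smooth_fun) simp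
  moreover have "bounded {x::'a. annulus_bump x \<noteq> 0}"
    using annulus_bump_eq_0 by (intro boundedI[of _ 2]) force
  ultimately show ?thesis by (simp add: Cc_infty_def compact_closure)
qed

lemma annulus_bump_le_1: "annulus_bump x \<le> 1"
  unfolding annulus_bump_def by (intro mult_le_one flat_0_bounds flat_nonneg)

text \<open>As a function of the squared norm the bump has Lipschitz constant 4, and squaring has
  constant 4 on \<open>[0, 2]\<close>.\<close>

lemma annulus_bump_lipschitz: "\<bar>annulus_bump x - annulus_bump y\<bar> \<le> 16 * norm (x - y)"
proof -
  define g where "g t = flat 0 (t - 1) * flat 0 (4 - t)" for t
  have g: "\<bar>g s - g t\<bar> \<le> 4 * \<bar>s - t\<bar>" for s t
  proof -
    have "g s - g t = flat 0 (s - 1) * (flat 0 (4 - s) - flat 0 (4 - t)) +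
        flat 0 (4 - t) * (flat 0 (s - 1) - flat 0 (t - 1))"
      by (simp add: g_def algebra_simps)
    also have "\<bar>\<dots>\<bar> \<le> 1 * (2 * \<bar>(4 - s) - (4 - t)\<bar>) + 1 * (2 * \<bar>(s - 1) - (t - 1)\<bar>)"
      unfolding abs_mult abs_of_nonneg[OF flat_nonneg]
      by (rule order_trans[OF abs_triangle_ineq], unfold abs_mult abs_of_nonneg[OF flat_nonneg])
         (intro add_mono mult_mono flat_0_bounds; simp add: flat_nonneg)
    finally show ?thesis by (simp add: abs_minus_commute[of t s])
  qed
  \<comment> \<open>Squaring is not globally Lipschitz, so the norm is cut off at 2; this changes
    nothing because \<open>g 4 = 0\<close> and the bump vanishes beyond radius 2.\<close>
  have gx: "annulus_bump x = g ((min (norm x) 2)\<^sup>2)" for x :: 'a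
    using annulus_bump_eq_0[of x]
    by (cases "norm x \<le> 2") (auto simp: annulus_bump_def g_def min_def flat_def)
  let ?a = "min (norm x) 2" and ?b = "min (norm y) 2"
  have "\<bar>?a\<^sup>2 - ?b\<^sup>2\<bar> = (?a + ?b) * \<bar>?a - ?b\<bar>"
    by (simp add: power2_eq_square square_diff_square_factored abs_mult)
  also have "\<dots> \<le> 4 * norm (x - y)"
    using norm_triangle_ineq3[of x y] by (intro mult_mono) (auto simp: min_def)
  finally show ?thesis using g[of "?a\<^sup>2" "?b\<^sup>2"] by (simp add: gx)
qed

text \<open>The bump is nonnegative with value 0 at the origin, so no term of the second difference
  is negative and the annulus contributes strictly.\<close>

lemma Lop_annulus_bump_pos:
  assumes \<beta>: "0 < \<beta>" "\<beta> < 2" and "admissible \<beta> (annulus_bump :: 'a::euclidean_space \<Rightarrow> real)"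
  shows "0 < Lop \<beta> (annulus_bump :: 'a \<Rightarrow> real) 0"
proof -
  let ?w = "annulus_bump :: 'a \<Rightarrow> real"
  let ?U = "{x::'a. 1 < norm x} \<inter> {x. norm x < 2}"
  obtain a :: 'a where "norm a = 3/2" using vector_choose_size[of "3/2"] by auto
  hence "a \<in> ?U" by simp
  moreover have "open ?U"
    by (intro open_Int open_Collect_less continuous_intros)
  moreover have "0 \<le> Lop_integrand \<beta> ?w x" for x
    by (simp add: Lop_integrand_def annulus_bump_nonneg annulus_bump_eq_0[of 0])
  moreover have "0 < Lop_integrand \<beta> ?w x" if "x \<in> ?U" for x
    using that annulus_bump_pos[of x] annulus_bump_nonneg[of "- x"]
    by (auto simp: Lop_integrand_def annulus_bump_eq_0[of 0] intro!: divide_pos_pos add_pos_nonneg)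
  ultimately have "0 < (\<integral>x. Lop_integrand \<beta> ?w x \<partial>lborel)"
    using assms by (intro integral_pos_open[of _ ?U]) (auto simp: admissible_def)
  thus ?thesis using c_const_pos[OF \<beta>] by (simp add: Lop_at_0)
qed

section \<open>Conclusion by iterating the doubling\<close>

theorem theorem3p5:
  fixes \<beta> \<mu> :: real
  assumes "0 < \<beta>" and "\<beta> < 2" and "0 < \<mu>"
  shows "\<exists>u :: 'a::euclidean_space \<Rightarrow> real.
           Cc_infty u \<and> (\<forall>x. norm x \<le> 1/4 \<longrightarrow> u x = 0) \<and>
           0 < Gamma2 \<beta> u 0 \<and> Gamma2 \<beta> u 0 < \<mu> * (Lop \<beta> u 0)\<^sup>2"
proof -
  let ?w = "annulus_bump :: 'a \<Rightarrow> real"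
  have w: "admissible \<beta> ?w"
    using assms
    by (intro admissibleI_bounded_lipschitz[where B = 1 and C = 16] Cc_infty_annulus_bump
        annulus_bump_eq_0 annulus_bump_lipschitz)
       (auto simp: abs_of_nonneg[OF annulus_bump_nonneg] annulus_bump_le_1)
  have L: "0 < Lop \<beta> ?w 0" using assms w by (intro Lop_annulus_bump_pos)
  hence G: "0 < Gamma2 \<beta> ?w 0" using assms w by (intro Gamma2_pos) auto
  \<comment> \<open>After \<open>n\<close> doublings \<open>Gamma2\<close> has grown by at most
    \<open>3 ^ n\<close> and the squared \<open>Lop\<close> by exactly \<open>4 ^ n\<close>.\<close>
  obtain n where "(3/4) ^ n < \<mu> * (Lop \<beta> ?w 0)\<^sup>2 / Gamma2 \<beta> ?w 0"
    using real_arch_pow_inv[of "\<mu> * (Lop \<beta> ?w 0)\<^sup>2 / Gamma2 \<beta> ?w 0" "3/4"] G L assms by auto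
  hence n: "3 ^ n * Gamma2 \<beta> ?w 0 < \<mu> * (2 ^ n * Lop \<beta> ?w 0)\<^sup>2"
    using G by (simp add: power_divide field_simps power2_eq_square flip: power_mult_distrib)
  obtain u :: "'a \<Rightarrow> real" where u: "admissible \<beta> u" "Lop \<beta> u 0 = 2 ^ n * Lop \<beta> ?w 0"
    "Gamma2 \<beta> u 0 \<le> 3 ^ n * Gamma2 \<beta> ?w 0"
    using admissible_iterate[OF w] by blast
  \<comment> \<open>Doubling only bounds \<open>Gamma2\<close> from above; positivity comes again
    from the nonzero value of \<open>Lop\<close>.\<close>
  have "0 < Gamma2 \<beta> u 0" using assms u L by (intro Gamma2_pos) auto
  moreover have "Gamma2 \<beta> u 0 < \<mu> * (Lop \<beta> u 0)\<^sup>2" using n u by simp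
  ultimately show ?thesis using u(1) by (intro exI[of _ u]) (auto simp: admissible_def)
qed

end
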